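(* Let $p:I\to M$ and $q:J\to M$ be category mappings, let $G$ be a group operating on $I$ and $J$ via a group action compatible with $(p,q)$, and let $f:\Theta\to\Delta^I$ and $g:\Theta\to\Delta^J$ be two $G$-invariant models. Then: (1) There is an induced action of $G$ on $I\times_M J$ given by $\alpha\cdot(i,j)=(\alpha\cdot i,\alpha\cdot j)$. (2) If $f$ and $g$ are jointly $G$-invariant and meta-consistent, then the meta-Markov combination $f\star g$ is $G$-invariant. (3) The lower Markov combination $f\mathbin{\underline\star}g$ is $G$-invariant. (4) The upper Markov combination $f\mathbin{\overline\star}g$ is $G$-invariant. (5) The super Markov combination $f\otimes g$ is $G$-invariant. If $h:\Theta\to\Delta^M$ is a $G$-invariant model, then the structured super Markov combination $f\otimes_h g$ is $G$-invariant.
   Context: Category mappings. For a finite set $I$, a category mapping of $I$ is a finite set $M$ together with a surjective function $p:I\to M$. For category mappings $p:I\to M$ and $q:J\to M$, the mapping product is $I\times_M J=\{(i,j)\in I\times J : p(i)=q(j)\}$. Models. For a finite set $I$, $\Delta^I$ is the probability simplex of vectors $(v_i)_{i\in I}$ with $v_i\ge 0$ and $\sum_i v_i=1$. A (parametric statistical) model over $I$ with parameter space $\Theta$ is a map $f:\Theta\to\Delta^I$, i.e. a family of functions $f_i:\Theta\to\mathbb R_{\ge 0}$, $i\in I$, with $\sum_{i\in I} f_i=1$. Models are regarded as vectors with entries in $K(\Theta)$, the field of ratios of functions $\Theta\to\mathbb R$ (and similarly for other parameter spaces); the quotients below are formed in this sense. Invariance. An action of a group $G$ on $I$, written $(\alpha,i)\mapsto\alpha\cdot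 i$, induces an action on $\Delta^I$ by $(\alpha\cdot v)_i=v_{\alpha^{-1}(i)}$. For $\alpha\in G$, a statistical model $f:\Theta\to\Delta^I$ is $\alpha$-invariant if there exists an injective function $\overline\alpha:\Theta\to\Theta$ such that $\alpha\circ f=f\circ\overline\alpha$, that is, $f(\theta)_{\alpha^{-1}(i)}=f(\overline\alpha(\theta))_i$ for all $\theta\in\Theta$, $i\in I$. The model $f$ is $G$-invariant if it is $\alpha$-invariant for all $\alpha\in G$. Two models $f:\Theta\to\Delta^I$ and $g:\Theta\to\Delta^J$ are jointly $G$-invariant if, for all $\alpha\in G$, both are $\alpha$-invariant via the same injective function $\overline\alpha:\Theta\to\Theta$. For the combined models below, which are models over $I\times_M J$ with the indicated parameter spaces, invariance is with respect to the action of $G$ on $I\times_M J$ in part (1). Compatibility. The action of $G$ on $I$ and $J$ is compatible with $(p,q)$ if for all $\alpha\in G$, $i\in I$, $j\in J$: $p(i)=q(j)$ implies $p(\alpha\cdot i)=q(\alpha\cdot j)$. In that case there is a well-defined induced action of $G$ on $M$ given by $\alpha\cdot p(i)=p(\alpha\cdot i)$; $G$-invariance of $h$ refers to this action. Aggregates. For a vector $f$ indexed by $I$, its aggregate $f_M$ is the vector indexed by $M$ with $f_{M,k}=\sum_{i\in I,\,p(i)=k}f_i$; for $g$ indexed by $J$, $g_{M,k}=\sum_{j\in J,\,q(j)=k}g_j$. Markov combinations of vectors. For vectors $f$ indexed by $I$ and $g$ indexed by $J$, the left and right Markov combinations are the vectors indexed by $(i,j)\in I\times_M J$ given by $(f\ast_M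 g)_{i,j}=\dfrac{f_i\,g_j}{f_{M,p(i)}}$ and $(f\,{}_M\!\ast g)_{i,j}=\dfrac{f_i\,g_j}{g_{M,q(j)}}$. The vectors $f$ and $g$ are consistent if $f_M=g_M$; in that case the two combinations coincide and $f\star g$ denotes their common value. Markov combinations of models $f$ over $I$ and $g$ over $J$, both with parameter space $\Theta$: - $f$ and $g$ are meta-consistent if for every $\theta\in\Theta$ the vectors $f(\theta)$ and $g(\theta)$ are consistent. Then the meta-Markov combination $f\star g$ has parameter space $\Theta$ and is obtained by taking the Markov combination pointwise: $(f\star g)(\theta)=f(\theta)\star g(\theta)$. - The lower Markov combination $f\mathbin{\underline\star}g$ has parameter space $\Theta'=\{(\theta_1,\theta_2)\in\Theta\times\Theta : f(\theta_1),g(\theta_2)\text{ consistent}\}$ and is given by $(f\mathbin{\underline\star}g)(\theta_1,\theta_2)=f(\theta_1)\star g(\theta_2)$. - The upper Markov combination $f\mathbin{\overline\star}g$ has parameter space $\Theta\times\Theta\times\{0,1\}$ and is given by $(f\mathbin{\overline\star}g)(\theta_1,\theta_2,0)=f(\theta_1)\ast_M g(\theta_2)$ and $(f\mathbin{\overline\star}g)(\theta_1,\theta_2,1)=f(\theta_1)\,{}_M\!\ast g(\theta_2)$. - The super Markov combination $f\otimes g$ has parameter space $\Theta^3\times\{0,1\}$ and is given, for $(i,j)\in I\times_M J$, by $$(f\otimes g)_{i,j}(\theta_1,\theta_2,\theta_3,0)=\frac{f_i(\theta_1)}{f_{M,p(i)}(\theta_1)}\cdot f_{M,p(i)}(\theta_2)\cdot\frac{g_j(\theta_3)}{g_{M,q(j)}(\theta_3)},$$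 $$(f\otimes g)_{i,j}(\theta_1,\theta_2,\theta_3,1)=\frac{f_i(\theta_1)}{f_{M,p(i)}(\theta_1)}\cdot g_{M,q(j)}(\theta_2)\cdot\frac{g_j(\theta_3)}{g_{M,q(j)}(\theta_3)}.$$ - For a model $h$ over $M$, here with parameter space $\Theta$, the structured super Markov combination $f\otimes_h g$ with respect to $h$ is the model over $I\times_M J$ parametrised by $(\theta_1,\theta_2,\theta_3)\in\Theta^3$ and given, for $k\in M$, $i$ with $p(i)=k$ and $j$ with $q(j)=k$, by $$(f\otimes_h g)_{i,j}(\theta_1,\theta_2,\theta_3)=\frac{f_i(\theta_1)}{f_{M,k}(\theta_1)}\cdot h_k(\theta_2)\cdot\frac{g_j(\theta_3)}{g_{M,k}(\theta_3)}.$$ *)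

theory Defs
  imports Complex_Main "HOL-Algebra.Group_Action"
begin

definition category_mapping :: "'i set \<Rightarrow> 'm set \<Rightarrow> ('i \<Rightarrow> 'm) \<Rightarrow> bool" where
  "category_mapping I M p \<longleftrightarrow> finite I \<and> finite M \<and> p ` I = M"

definition mapping_product ::
    "('i \<Rightarrow> 'm) \<Rightarrow> 'i set \<Rightarrow> ('j \<Rightarrow> 'm) \<Rightarrow> 'j set \<Rightarrow> ('i \<times> 'j) set" where
  "mapping_product p I q J = {(i, j) \<in> I \<times> J. p i = q j}"

definition prob_simplex :: "'i set \<Rightarrow> ('i \<Rightarrow> real) set" where
  "prob_simplex I = {v. (\<forall>i\<in>I. 0 \<le> v i) \<and> (\<Sum>i\<in>I. v i) = 1}"

definition stat_model :: "'t set \<Rightarrow> 'i set \<Rightarrow> ('t \<Rightarrow> 'i \<Rightarrow> real) \<Rightarrow> bool" where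
  "stat_model \<Theta> I f \<longleftrightarrow> (\<forall>\<theta>\<in>\<Theta>. f \<theta> \<in> prob_simplex I)"


section \<open>Invariance\<close>

definition act_vec ::
    "('g, 'b) monoid_scheme \<Rightarrow> ('g \<Rightarrow> 'i \<Rightarrow> 'i) \<Rightarrow> 'g \<Rightarrow> ('i \<Rightarrow> 'v) \<Rightarrow> 'i \<Rightarrow> 'v" where
  "act_vec G \<phi> \<alpha> v = (\<lambda>i. v (\<phi> (inv\<^bsub>G\<^esub> \<alpha>) i))"

text \<open>
  The type of entries \<open>'v\<close> is \<^typ>\<open>real\<close> for the given models and \<^typ>\<open>real option\<close> for the
  combined ones, whose entries are quotients; in the latter case the equation also says that
  the two sides are defined at the same parameters.
\<close>

definition invariant_via ::
    "('g, 'b) monoid_scheme \<Rightarrow> ('g \<Rightarrow> 'i \<Rightarrow> 'i) \<Rightarrow> 'i set \<Rightarrow> 't set \<Rightarrow> ('t \<Rightarrow> 'i \<Rightarrow> 'v)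
      \<Rightarrow> 'g \<Rightarrow> ('t \<Rightarrow> 't) \<Rightarrow> bool" where
  "invariant_via G \<phi> I \<Theta> f \<alpha> \<alpha>' \<longleftrightarrow>
     \<alpha>' ` \<Theta> \<subseteq> \<Theta> \<and> inj_on \<alpha>' \<Theta> \<and>
     (\<forall>\<theta>\<in>\<Theta>. \<forall>i\<in>I. act_vec G \<phi> \<alpha> (f \<theta>) i = f (\<alpha>' \<theta>) i)"

definition G_invariant ::
    "('g, 'b) monoid_scheme \<Rightarrow> ('g \<Rightarrow> 'i \<Rightarrow> 'i) \<Rightarrow> 'i set \<Rightarrow> 't set \<Rightarrow> ('t \<Rightarrow> 'i \<Rightarrow> 'v) \<Rightarrow> bool" where
  "G_invariant G \<phi> I \<Theta> f \<longleftrightarrow> (\<forall>\<alpha>\<in>carrier G. \<exists>\<alpha>'. invariant_via G \<phi> I \<Theta> f \<alpha> \<alpha>')"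

definition jointly_G_invariant ::
    "('g, 'b) monoid_scheme \<Rightarrow> ('g \<Rightarrow> 'i \<Rightarrow> 'i) \<Rightarrow> 'i set \<Rightarrow> ('g \<Rightarrow> 'j \<Rightarrow> 'j) \<Rightarrow> 'j set
      \<Rightarrow> 't set \<Rightarrow> ('t \<Rightarrow> 'i \<Rightarrow> 'v) \<Rightarrow> ('t \<Rightarrow> 'j \<Rightarrow> 'w) \<Rightarrow> bool" where
  "jointly_G_invariant G \<phi> I \<psi> J \<Theta> f g \<longleftrightarrow>
     (\<forall>\<alpha>\<in>carrier G. \<exists>\<alpha>'. invariant_via G \<phi> I \<Theta> f \<alpha> \<alpha>' \<and> invariant_via G \<psi> J \<Theta> g \<alpha> \<alpha>')"

definition compatible_action ::
    "('g, 'b) monoid_scheme \<Rightarrow> ('g \<Rightarrow> 'i \<Rightarrow> 'i) \<Rightarrow> 'i set \<Rightarrow> ('g \<Rightarrow> 'j \<Rightarrow> 'j) \<Rightarrow> 'j set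
      \<Rightarrow> ('i \<Rightarrow> 'm) \<Rightarrow> ('j \<Rightarrow> 'm) \<Rightarrow> bool" where
  "compatible_action G \<phi> I \<psi> J p q \<longleftrightarrow>
     (\<forall>\<alpha>\<in>carrier G. \<forall>i\<in>I. \<forall>j\<in>J. p i = q j \<longrightarrow> p (\<phi> \<alpha> i) = q (\<psi> \<alpha> j))"

text \<open>
  As in \<^theory>\<open>HOL-Algebra.Group_Action\<close>, the maps given by an action on a set are
  extensional on that set, hence the restrictions.
\<close>

definition base_action :: "('i \<Rightarrow> 'm) \<Rightarrow> 'i set \<Rightarrow> 'm set \<Rightarrow> ('g \<Rightarrow> 'i \<Rightarrow> 'i) \<Rightarrow> 'g \<Rightarrow> 'm \<Rightarrow> 'm" where
  "base_action p I M \<phi> \<alpha> = (\<lambda>k\<in>M. THE l. \<exists>i\<in>I. p i = k \<and> p (\<phi> \<alpha> i) = l)"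

definition prod_action ::
    "('i \<Rightarrow> 'm) \<Rightarrow> 'i set \<Rightarrow> ('j \<Rightarrow> 'm) \<Rightarrow> 'j set \<Rightarrow> ('g \<Rightarrow> 'i \<Rightarrow> 'i) \<Rightarrow> ('g \<Rightarrow> 'j \<Rightarrow> 'j)
      \<Rightarrow> 'g \<Rightarrow> 'i \<times> 'j \<Rightarrow> 'i \<times> 'j" where
  "prod_action p I q J \<phi> \<psi> \<alpha> = (\<lambda>(i, j)\<in>mapping_product p I q J. (\<phi> \<alpha> i, \<psi> \<alpha> j))"

text \<open>
  The induced action on \<open>M\<close> is well defined: the description in \<^const>\<open>base_action\<close> picks out
  exactly one element.
\<close>

lemma base_action_eq:
  assumes "category_mapping I M p" "category_mapping J M q"
    and "compatible_action G \<phi> I \<psi> J p q" and "\<alpha> \<in> carrier G" "i \<in> I"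
  shows "base_action p I M \<phi> \<alpha> (p i) = p (\<phi> \<alpha> i)"
proof -
  have pi: "p i \<in> M" using assms by (auto simp: category_mapping_def)
  then obtain j where j: "j \<in> J" "q j = p i"
    using assms(2) by (force simp: category_mapping_def)
  have "p (\<phi> \<alpha> i') = q (\<psi> \<alpha> j)" if "i' \<in> I" "p i' = p i" for i'
    using assms(3,4) j that unfolding compatible_action_def by metis
  then have "(THE l. \<exists>i'\<in>I. p i' = p i \<and> p (\<phi> \<alpha> i') = l) = p (\<phi> \<alpha> i)"
    using assms(5) by (intro the_equality) auto
  then show ?thesis using pi by (simp add: base_action_def)
qed


section \<open>Markov combinations\<close>

text \<open>
  A ratio of functions on a parameter space is the partial function that is defined exactly
  where its denominators do not vanish. In particular \<open>0 / 0\<close> is undefined.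
\<close>

definition quot :: "real \<Rightarrow> real \<Rightarrow> real option"  (infixl "'/\<^sub>K" 70) where
  "x /\<^sub>K y = (if y = 0 then None else Some (x / y))"

definition ktimes :: "real option \<Rightarrow> real option \<Rightarrow> real option"  (infixl "*\<^sub>K" 70) where
  "a *\<^sub>K b = Option.bind a (\<lambda>x. Option.bind b (\<lambda>y. Some (x * y)))"

definition aggregate :: "('i \<Rightarrow> 'm) \<Rightarrow> 'i set \<Rightarrow> ('i \<Rightarrow> real) \<Rightarrow> 'm \<Rightarrow> real" where
  "aggregate p I v k = (\<Sum>i | i \<in> I \<and> p i = k. v i)"

definition left_markov ::
    "('i \<Rightarrow> 'm) \<Rightarrow> 'i set \<Rightarrow> ('i \<Rightarrow> real) \<Rightarrow> ('j \<Rightarrow> real) \<Rightarrow> 'i \<times> 'j \<Rightarrow> real option" where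
  "left_markov p I u v = (\<lambda>(i, j). (u i * v j) /\<^sub>K aggregate p I u (p i))"

definition right_markov ::
    "('j \<Rightarrow> 'm) \<Rightarrow> 'j set \<Rightarrow> ('i \<Rightarrow> real) \<Rightarrow> ('j \<Rightarrow> real) \<Rightarrow> 'i \<times> 'j \<Rightarrow> real option" where
  "right_markov q J u v = (\<lambda>(i, j). (u i * v j) /\<^sub>K aggregate q J v (q j))"

definition consistent ::
    "('i \<Rightarrow> 'm) \<Rightarrow> 'i set \<Rightarrow> ('j \<Rightarrow> 'm) \<Rightarrow> 'j set \<Rightarrow> 'm set \<Rightarrow> ('i \<Rightarrow> real) \<Rightarrow> ('j \<Rightarrow> real) \<Rightarrow> bool" where
  "consistent p I q J M u v \<longleftrightarrow> (\<forall>k\<in>M. aggregate p I u k = aggregate q J v k)"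

lemma left_markov_eq_right_markov:
  assumes "category_mapping I M p" "consistent p I q J M u v" "x \<in> mapping_product p I q J"
  shows "left_markov p I u v x = right_markov q J u v x"
proof -
  obtain i j where x: "x = (i, j)" "i \<in> I" "p i = q j"
    using assms(3) by (auto simp: mapping_product_def)
  have "p i \<in> M" using assms(1) x(2) unfolding category_mapping_def by blast
  then have "aggregate p I u (p i) = aggregate q J v (q j)"
    using assms(2) x(3) by (auto simp: consistent_def)
  then show ?thesis by (simp add: left_markov_def right_markov_def x(1))
qed

definition meta_consistent ::
    "('i \<Rightarrow> 'm) \<Rightarrow> 'i set \<Rightarrow> ('j \<Rightarrow> 'm) \<Rightarrow> 'j set \<Rightarrow> 'm set \<Rightarrow> 't set
      \<Rightarrow> ('t \<Rightarrow> 'i \<Rightarrow> real) \<Rightarrow> ('t \<Rightarrow> 'j \<Rightarrow> real) \<Rightarrow> bool" where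
  "meta_consistent p I q J M \<Theta> f g \<longleftrightarrow> (\<forall>\<theta>\<in>\<Theta>. consistent p I q J M (f \<theta>) (g \<theta>))"

text \<open>
  For consistent vectors the left and right combinations agree by
  \<open>left_markov_eq_right_markov\<close>, so the left one serves as their common value below.
\<close>

definition meta_markov ::
    "('i \<Rightarrow> 'm) \<Rightarrow> 'i set \<Rightarrow> ('t \<Rightarrow> 'i \<Rightarrow> real) \<Rightarrow> ('t \<Rightarrow> 'j \<Rightarrow> real)
      \<Rightarrow> 't \<Rightarrow> 'i \<times> 'j \<Rightarrow> real option" where
  "meta_markov p I f g = (\<lambda>\<theta>. left_markov p I (f \<theta>) (g \<theta>))"

definition lower_params ::
    "('i \<Rightarrow> 'm) \<Rightarrow> 'i set \<Rightarrow> ('j \<Rightarrow> 'm) \<Rightarrow> 'j set \<Rightarrow> 'm set \<Rightarrow> 't set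
      \<Rightarrow> ('t \<Rightarrow> 'i \<Rightarrow> real) \<Rightarrow> ('t \<Rightarrow> 'j \<Rightarrow> real) \<Rightarrow> ('t \<times> 't) set" where
  "lower_params p I q J M \<Theta> f g =
     {(\<theta>1, \<theta>2) \<in> \<Theta> \<times> \<Theta>. consistent p I q J M (f \<theta>1) (g \<theta>2)}"

definition lower_markov ::
    "('i \<Rightarrow> 'm) \<Rightarrow> 'i set \<Rightarrow> ('t \<Rightarrow> 'i \<Rightarrow> real) \<Rightarrow> ('t \<Rightarrow> 'j \<Rightarrow> real)
      \<Rightarrow> 't \<times> 't \<Rightarrow> 'i \<times> 'j \<Rightarrow> real option" where
  "lower_markov p I f g = (\<lambda>(\<theta>1, \<theta>2). left_markov p I (f \<theta>1) (g \<theta>2))"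

definition upper_markov ::
    "('i \<Rightarrow> 'm) \<Rightarrow> 'i set \<Rightarrow> ('j \<Rightarrow> 'm) \<Rightarrow> 'j set \<Rightarrow> ('t \<Rightarrow> 'i \<Rightarrow> real) \<Rightarrow> ('t \<Rightarrow> 'j \<Rightarrow> real)
      \<Rightarrow> 't \<times> 't \<times> nat \<Rightarrow> 'i \<times> 'j \<Rightarrow> real option" where
  "upper_markov p I q J f g = (\<lambda>(\<theta>1, \<theta>2, s).
     if s = 0 then left_markov p I (f \<theta>1) (g \<theta>2) else right_markov q J (f \<theta>1) (g \<theta>2))"

definition super_markov ::
    "('i \<Rightarrow> 'm) \<Rightarrow> 'i set \<Rightarrow> ('j \<Rightarrow> 'm) \<Rightarrow> 'j set \<Rightarrow> ('t \<Rightarrow> 'i \<Rightarrow> real) \<Rightarrow> ('t \<Rightarrow> 'j \<Rightarrow> real)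
      \<Rightarrow> 't \<times> 't \<times> 't \<times> nat \<Rightarrow> 'i \<times> 'j \<Rightarrow> real option" where
  "super_markov p I q J f g = (\<lambda>(\<theta>1, \<theta>2, \<theta>3, s) (i, j).
     (f \<theta>1 i /\<^sub>K aggregate p I (f \<theta>1) (p i))
     *\<^sub>K Some (if s = 0 then aggregate p I (f \<theta>2) (p i) else aggregate q J (g \<theta>2) (q j))
     *\<^sub>K (g \<theta>3 j /\<^sub>K aggregate q J (g \<theta>3) (q j)))"

definition structured_super_markov ::
    "('i \<Rightarrow> 'm) \<Rightarrow> 'i set \<Rightarrow> ('j \<Rightarrow> 'm) \<Rightarrow> 'j set \<Rightarrow> ('t \<Rightarrow> 'm \<Rightarrow> real)
      \<Rightarrow> ('t \<Rightarrow> 'i \<Rightarrow> real) \<Rightarrow> ('t \<Rightarrow> 'j \<Rightarrow> real) \<Rightarrow> 't \<times> 't \<times> 't \<Rightarrow> 'i \<times> 'j \<Rightarrow> real option" where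
  "structured_super_markov p I q J h f g = (\<lambda>(\<theta>1, \<theta>2, \<theta>3) (i, j).
     (f \<theta>1 i /\<^sub>K aggregate p I (f \<theta>1) (p i))
     *\<^sub>K Some (h \<theta>2 (p i))
     *\<^sub>K (g \<theta>3 j /\<^sub>K aggregate q J (g \<theta>3) (q j)))"

end

theory Submission
  imports Defs
begin

text \<open>
  Write \<open>a\<close> for the inverse of \<open>\<alpha>\<close>. Compatibility, surjectivity of the category mappings and
  invertibility of \<open>a\<close> make \<open>a\<close> permute the fibres of \<open>p\<close> and of \<open>q\<close>. So if
  \<open>f (\<alpha>' \<theta>) i = f \<theta> (a \<cdot> i)\<close> for all \<open>i\<close>, the same relation holds between the aggregates, and
  all numerators and denominators in a combination are transported by the same permutation.
  Each combined model is therefore invariant via the product of the maps \<open>\<alpha>'\<close> acting on the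
  separate parameters.
\<close>

section \<open>Fibres and aggregates under a compatible action\<close>

text \<open>Allows a fact proved for the fibres of \<open>p\<close> to be reused for those of
  \<open>q\<close>.\<close>

lemma compatible_action_sym:
  "compatible_action G \<phi> I \<psi> J p q \<Longrightarrow> compatible_action G \<psi> J \<phi> I q p"
  unfolding compatible_action_def by metis

lemma (in group_action) inv_action_cancel:
  assumes "\<alpha> \<in> carrier G" "x \<in> E"
  shows "\<phi> (inv\<^bsub>G\<^esub> \<alpha>) (\<phi> \<alpha> x) = x"
  using orbit_sym_aux[OF assms refl] .

text \<open>By \<open>base_action_eq\<close>, the fibre containing \<open>\<phi> \<alpha> i\<close>
  depends only on the fibre containing \<open>i\<close>. This is one direction; the same fact for
  the inverse of \<alpha>, applied to the two images, gives the other.\<close>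

lemma compatible_action_fibre_iff:
  assumes M: "category_mapping I M p" "category_mapping J M q"
    and \<phi>: "group_action G I \<phi>" and c: "compatible_action G \<phi> I \<psi> J p q"
    and \<alpha>: "\<alpha> \<in> carrier G" and i: "i \<in> I" "i' \<in> I"
  shows "p (\<phi> \<alpha> i) = p (\<phi> \<alpha> i') \<longleftrightarrow> p i = p i'"
proof -
  interpret group_action G I \<phi> by fact
  have *: "p (\<phi> \<beta> x) = p (\<phi> \<beta> y)"
    if "\<beta> \<in> carrier G" "x \<in> I" "y \<in> I" "p x = p y" for \<beta> x y
    using base_action_eq[OF M c] that by metis
  have "inv\<^bsub>G\<^esub> \<alpha> \<in> carrier G"
    using \<alpha> group_hom by (simp add: group_hom_def)
  then show ?thesis
    using *[of \<alpha> i i'] *[of "inv\<^bsub>G\<^esub> \<alpha>" "\<phi> \<alpha> i" "\<phi> \<alpha> i'"] \<alpha> i element_image inv_action_cancel by auto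
qed

text \<open>The map \<open>\<phi> a\<close> is a bijection from the fibre through \<open>i\<close>
  onto the fibre through \<open>\<phi> a i\<close>, so the sum can be reindexed. In the applications
  \<open>a\<close> is the inverse of \<alpha>, \<open>u\<close> is a vector of the model and
  \<open>u'\<close> the vector at the moved parameter.\<close>

lemma aggregate_action:
  assumes M: "category_mapping I M p" "category_mapping J M q"
    and \<phi>: "group_action G I \<phi>" and c: "compatible_action G \<phi> I \<psi> J p q"
    and a: "a \<in> carrier G" and i: "i \<in> I"
    and u: "\<And>x. x \<in> I \<Longrightarrow> u (\<phi> a x) = u' x"
  shows "aggregate p I u (p (\<phi> a i)) = aggregate p I u' (p i)"
proof -
  interpret group_action G I \<phi> by fact
  have fibre: "\<phi> a ` {x. x \<in> I \<and> p x = p i} = {x. x \<in> I \<and> p x = p (\<phi> a i)}"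
  proof (intro equalityI subsetI)
    fix y assume y: "y \<in> {x. x \<in> I \<and> p x = p (\<phi> a i)}"
    \<comment> \<open>A preimage exists because \<open>\<phi> a\<close> is onto \<open>I\<close>;
      that it lies in the right fibre is the direction of \<open>compatible_action_fibre_iff\<close>
      that rests on the inverse.\<close>
    then obtain x where "x \<in> I" "y = \<phi> a x"
      using surj_prop[OF a] by auto
    then show "y \<in> \<phi> a ` {x. x \<in> I \<and> p x = p i}"
      using y compatible_action_fibre_iff[OF M \<phi> c a _ i] by auto
  qed (use compatible_action_fibre_iff[OF M \<phi> c a _ i] element_image[OF a] in auto)
  have "inj_on (\<phi> a) {x. x \<in> I \<and> p x = p i}"
    using inj_prop[OF a] by (rule inj_on_subset) auto
  then show ?thesis
    unfolding aggregate_def fibre[symmetric] by (simp add: sum.reindex u)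
qed

lemma invariant_viaD:
  assumes "invariant_via G \<phi> I \<Theta> f \<alpha> \<alpha>'"
  shows "\<theta> \<in> \<Theta> \<Longrightarrow> \<alpha>' \<theta> \<in> \<Theta>" "inj_on \<alpha>' \<Theta>"
    "\<theta> \<in> \<Theta> \<Longrightarrow> i \<in> I \<Longrightarrow> f \<theta> (\<phi> (inv\<^bsub>G\<^esub> \<alpha>) i) = f (\<alpha>' \<theta>) i"
  using assms unfolding invariant_via_def act_vec_def by blast+

locale compatible_group_actions =
  fixes G :: "('g, 'b) monoid_scheme" (structure)
    and I :: "'i set" and J :: "'j set" and M :: "'m set"
    and p :: "'i \<Rightarrow> 'm" and q :: "'j \<Rightarrow> 'm"
    and \<phi> :: "'g \<Rightarrow> 'i \<Rightarrow> 'i" and \<psi> :: "'g \<Rightarrow> 'j \<Rightarrow> 'j"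
  assumes p: "category_mapping I M p" and q: "category_mapping J M q"
    and \<phi>: "group_action G I \<phi>" and \<psi>: "group_action G J \<psi>"
    and compatible: "compatible_action G \<phi> I \<psi> J p q"
begin

sublocale I: group_action G I \<phi> by (rule \<phi>)
sublocale J: group_action G J \<psi> by (rule \<psi>)
sublocale group G using I.group_hom by (simp add: group_hom_def)

abbreviation "IJ \<equiv> mapping_product p I q J"
abbreviation "\<pi> \<equiv> prod_action p I q J \<phi> \<psi>"

section \<open>The action on the mapping product\<close>

lemma prod_action_eq: "(i, j) \<in> IJ \<Longrightarrow> \<pi> \<alpha> (i, j) = (\<phi> \<alpha> i, \<psi> \<alpha> j)"
  by (simp add: prod_action_def)

lemma fibre_permutation:
  assumes "(i, j) \<in> IJ" "a \<in> carrier G"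
  shows "i \<in> I" "j \<in> J" "p i = q j" "p (\<phi> a i) = q (\<psi> a j)"
proof -
  show *: "i \<in> I" "j \<in> J" "p i = q j"
    using assms(1) by (auto simp: mapping_product_def)
  show "p (\<phi> a i) = q (\<psi> a j)"
    using compatible assms(2) * unfolding compatible_action_def by blast
qed

lemma prod_action_closed:
  assumes "\<alpha> \<in> carrier G" "x \<in> IJ"
  shows "\<pi> \<alpha> x \<in> IJ"
proof -
  obtain i j where x: "x = (i, j)" by fastforce
  note ij = fibre_permutation[OF assms(2)[unfolded x] assms(1)]
  have "\<phi> \<alpha> i \<in> I" "\<psi> \<alpha> j \<in> J"
    using I.element_image[OF assms(1) ij(1) refl] J.element_image[OF assms(1) ij(2) refl] .
  then show ?thesis
    using ij(4) assms(2) by (simp add: x prod_action_eq) (simp add: mapping_product_def)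
qed

lemma prod_action_inv_cancel:
  assumes "\<alpha> \<in> carrier G" "x \<in> IJ"
  shows "\<pi> (inv \<alpha>) (\<pi> \<alpha> x) = x"
proof -
  obtain i j where x: "x = (i, j)" by fastforce
  note ij = fibre_permutation[OF assms(2)[unfolded x] assms(1)]
  have "(\<phi> \<alpha> i, \<psi> \<alpha> j) \<in> IJ"
    using prod_action_closed[OF assms] assms(2) by (simp add: x prod_action_eq)
  then show ?thesis
    using assms ij by (simp add: x prod_action_eq I.inv_action_cancel J.inv_action_cancel)
qed

lemma prod_action_Bij:
  assumes "\<alpha> \<in> carrier G"
  shows "\<pi> \<alpha> \<in> Bij IJ"
proof -
  \<comment> \<open>The action of \<open>inv \<alpha>\<close> is a two-sided inverse: cancellation
    is used once for \<alpha> and once for \<open>inv \<alpha>\<close>, whose inverse is \<alpha>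
    again.\<close>
  have "bij_betw (\<pi> \<alpha>) IJ IJ"
    using assms prod_action_closed prod_action_inv_cancel[of \<alpha>] prod_action_inv_cancel[of "inv \<alpha>"]
    by (intro bij_betw_byWitness[where f' = "\<pi> (inv \<alpha>)"]) auto
  then show ?thesis by (auto simp: Bij_def prod_action_def)
qed

lemma prod_action_mult:
  assumes "\<alpha> \<in> carrier G" "\<beta> \<in> carrier G"
  shows "\<pi> (\<alpha> \<otimes> \<beta>) = compose IJ (\<pi> \<alpha>) (\<pi> \<beta>)"
proof
  \<comment> \<open>On \<open>IJ\<close> the composition rules apply in each component. Off
    \<open>IJ\<close> both sides are \<open>undefined\<close>, by the restriction in
    \<open>prod_action\<close> and in \<open>compose\<close>.\<close>
  fix x show "\<pi> (\<alpha> \<otimes> \<beta>) x = compose IJ (\<pi> \<alpha>) (\<pi> \<beta>) x"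
    using assms prod_action_closed[of \<beta> x]
    by (cases x, cases "x \<in> IJ")
      (auto simp: prod_action_def compose_def mapping_product_def
        I.composition_rule J.composition_rule)
qed

lemma prod_group_action: "group_action G IJ \<pi>"
  unfolding group_action_def group_hom_def group_hom_axioms_def
  using group_BijGroup[of IJ] prod_action_mult prod_action_Bij
  by (auto simp: hom_def BijGroup_def)

section \<open>Transport of aggregates, Markov combinations and consistency\<close>

lemma aggregate_p_action:
  assumes "a \<in> carrier G" "i \<in> I" "\<And>x. x \<in> I \<Longrightarrow> u (\<phi> a x) = u' x"
  shows "aggregate p I u (p (\<phi> a i)) = aggregate p I u' (p i)"
  by (rule aggregate_action[OF p q \<phi> compatible assms(1,2)]) (rule assms(3))

lemma aggregate_q_action:
  assumes "a \<in> carrier G" "j \<in> J" "\<And>x. x \<in> J \<Longrightarrow> v (\<psi> a x) = v' x"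
  shows "aggregate q J v (q (\<psi> a j)) = aggregate q J v' (q j)"
  by (rule aggregate_action[OF q p \<psi> compatible_action_sym[OF compatible] assms(1,2)])
    (rule assms(3))

text \<open>The numerators agree factor by factor and the denominators by
  \<open>aggregate_p_action\<close>. Equal denominators also vanish together, so both sides are
  defined or undefined alike.\<close>

lemma left_markov_action:
  assumes "(i, j) \<in> IJ" "a \<in> carrier G"
    and "\<And>x. x \<in> I \<Longrightarrow> u (\<phi> a x) = u' x" "\<And>x. x \<in> J \<Longrightarrow> v (\<psi> a x) = v' x"
  shows "left_markov p I u v (\<phi> a i, \<psi> a j) = left_markov p I u' v' (i, j)"
  using aggregate_p_action[of a i u u'] fibre_permutation(1,2)[OF assms(1,2)] assms(2-)
  by (simp add: left_markov_def)

lemma right_markov_action: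
  assumes "(i, j) \<in> IJ" "a \<in> carrier G"
    and "\<And>x. x \<in> I \<Longrightarrow> u (\<phi> a x) = u' x" "\<And>x. x \<in> J \<Longrightarrow> v (\<psi> a x) = v' x"
  shows "right_markov q J u v (\<phi> a i, \<psi> a j) = right_markov q J u' v' (i, j)"
  using aggregate_q_action[of a j v v'] fibre_permutation(1,2)[OF assms(1,2)] assms(2-)
  by (simp add: right_markov_def)

text \<open>This keeps the parameter space of the lower combination closed under the parameter map.
  By surjectivity every \<open>k\<close> has some \<open>(i, j)\<close> in \<open>IJ\<close> above
  it; the aggregates of \<open>u'\<close> and \<open>v'\<close> at \<open>k\<close> are those of
  \<open>u\<close> and \<open>v\<close> at the moved point of \<open>M\<close>, where they
  agree.\<close>

lemma consistent_action:
  assumes a: "a \<in> carrier G" and cons: "consistent p I q J M u v"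
    and u: "\<And>x. x \<in> I \<Longrightarrow> u (\<phi> a x) = u' x" and v: "\<And>x. x \<in> J \<Longrightarrow> v (\<psi> a x) = v' x"
  shows "consistent p I q J M u' v'"
  unfolding consistent_def
proof
  fix k assume "k \<in> M"
  then obtain i j where ij: "i \<in> I" "p i = k" "j \<in> J" "q j = k"
    using p q unfolding category_mapping_def by (metis imageE)
  then have "(i, j) \<in> IJ" by (simp add: mapping_product_def)
  note perm = fibre_permutation[OF this a]
  have "p (\<phi> a i) \<in> M"
    using p a ij(1) I.element_image unfolding category_mapping_def by blast
  then have "aggregate p I u (p (\<phi> a i)) = aggregate q J v (q (\<psi> a j))"
    using cons perm by (simp add: consistent_def)
  then show "aggregate p I u' k = aggregate q J v' k"
    using aggregate_p_action[of a i u u'] aggregate_q_action[of a j v v'] a u v ij by simp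
qed

section \<open>Invariance of the combined models\<close>

text \<open>Unfolds the restricted action on pairs once and for all, so that each combination only
  needs a parameter map and an identity between entries.\<close>

lemma G_invariant_prodI:
  assumes "\<And>\<alpha>. \<alpha> \<in> carrier G \<Longrightarrow> \<exists>\<alpha>'. \<alpha>' ` \<Theta> \<subseteq> \<Theta> \<and> inj_on \<alpha>' \<Theta> \<and>
    (\<forall>\<theta>\<in>\<Theta>. \<forall>i j. (i, j) \<in> IJ \<longrightarrow> F \<theta> (\<phi> (inv \<alpha>) i, \<psi> (inv \<alpha>) j) = F (\<alpha>' \<theta>) (i, j))"
  shows "G_invariant G \<pi> IJ \<Theta> F"
  unfolding G_invariant_def
proof
  fix \<alpha> assume "\<alpha> \<in> carrier G"
  from assms[OF this] obtain \<alpha>' where "\<alpha>' ` \<Theta> \<subseteq> \<Theta>" "inj_on \<alpha>' \<Theta>"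
    "\<And>\<theta> i j. \<theta> \<in> \<Theta> \<Longrightarrow> (i, j) \<in> IJ \<Longrightarrow> F \<theta> (\<phi> (inv \<alpha>) i, \<psi> (inv \<alpha>) j) = F (\<alpha>' \<theta>) (i, j)"
    by blast
  then show "\<exists>\<alpha>'. invariant_via G \<pi> IJ \<Theta> F \<alpha> \<alpha>'"
    by (intro exI[of _ \<alpha>']) (auto simp: invariant_via_def act_vec_def prod_action_eq)
qed

text \<open>A single parameter feeds both \<open>f\<close> and \<open>g\<close>, so one map has to
  transport both; joint invariance supplies it.\<close>

lemma meta_markov_invariant:
  assumes "jointly_G_invariant G \<phi> I \<psi> J \<Theta> f g"
  shows "G_invariant G \<pi> IJ \<Theta> (meta_markov p I f g)"
proof (rule G_invariant_prodI)
  fix \<alpha> assume \<alpha>: "\<alpha> \<in> carrier G"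
  then obtain \<alpha>' where "invariant_via G \<phi> I \<Theta> f \<alpha> \<alpha>'" "invariant_via G \<psi> J \<Theta> g \<alpha> \<alpha>'"
    using assms by (auto simp: jointly_G_invariant_def)
  note inv = this[THEN invariant_viaD(1)] this[THEN invariant_viaD(2)]
    this[THEN invariant_viaD(3)]
  show "\<exists>\<alpha>'. \<alpha>' ` \<Theta> \<subseteq> \<Theta> \<and> inj_on \<alpha>' \<Theta> \<and> (\<forall>\<theta>\<in>\<Theta>. \<forall>i j. (i, j) \<in> IJ \<longrightarrow>
      meta_markov p I f g \<theta> (\<phi> (inv \<alpha>) i, \<psi> (inv \<alpha>) j) = meta_markov p I f g (\<alpha>' \<theta>) (i, j))"
    using inv \<alpha> by (intro exI[of _ \<alpha>']) (auto simp: meta_markov_def intro!: left_markov_action)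
qed

context
  fixes \<Theta> :: "'t set" and f :: "'t \<Rightarrow> 'i \<Rightarrow> real" and g :: "'t \<Rightarrow> 'j \<Rightarrow> real"
  assumes f: "G_invariant G \<phi> I \<Theta> f" and g: "G_invariant G \<psi> J \<Theta> g"
begin

lemma lower_markov_invariant:
  "G_invariant G \<pi> IJ (lower_params p I q J M \<Theta> f g) (lower_markov p I f g)"
    (is "G_invariant _ _ _ ?\<Theta>' ?F")
proof (rule G_invariant_prodI)
  fix \<alpha> assume \<alpha>: "\<alpha> \<in> carrier G"
  then obtain \<alpha>\<^sub>f \<alpha>\<^sub>g
    where \<alpha>\<^sub>f: "invariant_via G \<phi> I \<Theta> f \<alpha> \<alpha>\<^sub>f" and \<alpha>\<^sub>g: "invariant_via G \<psi> J \<Theta> g \<alpha> \<alpha>\<^sub>g"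
    using f g unfolding G_invariant_def by blast
  note maps = invariant_viaD[OF \<alpha>\<^sub>f] invariant_viaD[OF \<alpha>\<^sub>g]
  \<comment> \<open>The two vectors have separate parameters, so the maps for \<open>f\<close> and
    \<open>g\<close> may be chosen independently.\<close>
  let ?m = "map_prod \<alpha>\<^sub>f \<alpha>\<^sub>g"
  have "inj_on ?m ?\<Theta>'"
    using map_prod_inj_on[OF maps(2,5)] by (rule inj_on_subset) (auto simp: lower_params_def)
  \<comment> \<open>The moved pair must again be consistent, which is
    \<open>consistent_action\<close> for \<open>inv \<alpha>\<close>.\<close>
  moreover have "?m ` ?\<Theta>' \<subseteq> ?\<Theta>'"
    using \<alpha> maps
    by (auto simp: lower_params_def intro: consistent_action[of "inv \<alpha>"])
  moreover have "\<forall>\<theta>\<in>?\<Theta>'. \<forall>i j. (i, j) \<in> IJ \<longrightarrow>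
      ?F \<theta> (\<phi> (inv \<alpha>) i, \<psi> (inv \<alpha>) j) = ?F (?m \<theta>) (i, j)"
    using \<alpha> maps by (auto simp: lower_markov_def lower_params_def intro!: left_markov_action)
  ultimately show "\<exists>\<alpha>'. \<alpha>' ` ?\<Theta>' \<subseteq> ?\<Theta>' \<and> inj_on \<alpha>' ?\<Theta>' \<and> (\<forall>\<theta>\<in>?\<Theta>'. \<forall>i j. (i, j) \<in> IJ \<longrightarrow>
      ?F \<theta> (\<phi> (inv \<alpha>) i, \<psi> (inv \<alpha>) j) = ?F (\<alpha>' \<theta>) (i, j))"
    by blast
qed

lemma upper_markov_invariant:
  "G_invariant G \<pi> IJ (\<Theta> \<times> \<Theta> \<times> {0, 1}) (upper_markov p I q J f g)"
    (is "G_invariant _ _ _ ?\<Theta>' ?F")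
proof (rule G_invariant_prodI)
  fix \<alpha> assume \<alpha>: "\<alpha> \<in> carrier G"
  then obtain \<alpha>\<^sub>f \<alpha>\<^sub>g
    where \<alpha>\<^sub>f: "invariant_via G \<phi> I \<Theta> f \<alpha> \<alpha>\<^sub>f" and \<alpha>\<^sub>g: "invariant_via G \<psi> J \<Theta> g \<alpha> \<alpha>\<^sub>g"
    using f g unfolding G_invariant_def by blast
  note maps = invariant_viaD[OF \<alpha>\<^sub>f] invariant_viaD[OF \<alpha>\<^sub>g]
  \<comment> \<open>The flag stays fixed, so left combinations go to left ones and right
    combinations to right ones.\<close>
  let ?m = "map_prod \<alpha>\<^sub>f (map_prod \<alpha>\<^sub>g id)"
  have "inj_on ?m ?\<Theta>'"
    by (intro map_prod_inj_on maps(2,5) inj_on_id)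
  moreover have "?m ` ?\<Theta>' \<subseteq> ?\<Theta>'"
    using maps by auto
  moreover have "\<forall>\<theta>\<in>?\<Theta>'. \<forall>i j. (i, j) \<in> IJ \<longrightarrow>
      ?F \<theta> (\<phi> (inv \<alpha>) i, \<psi> (inv \<alpha>) j) = ?F (?m \<theta>) (i, j)"
    using \<alpha> maps
    by (auto simp: upper_markov_def intro!: left_markov_action right_markov_action)
  ultimately show "\<exists>\<alpha>'. \<alpha>' ` ?\<Theta>' \<subseteq> ?\<Theta>' \<and> inj_on \<alpha>' ?\<Theta>' \<and> (\<forall>\<theta>\<in>?\<Theta>'. \<forall>i j. (i, j) \<in> IJ \<longrightarrow>
      ?F \<theta> (\<phi> (inv \<alpha>) i, \<psi> (inv \<alpha>) j) = ?F (\<alpha>' \<theta>) (i, j))"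
    by blast
qed

lemma super_markov_invariant:
  "G_invariant G \<pi> IJ (\<Theta> \<times> \<Theta> \<times> \<Theta> \<times> {0, 1}) (super_markov p I q J f g)"
    (is "G_invariant _ _ _ ?\<Theta>' ?F")
proof (rule G_invariant_prodI)
  fix \<alpha> assume \<alpha>: "\<alpha> \<in> carrier G"
  then obtain \<alpha>\<^sub>f \<alpha>\<^sub>g
    where \<alpha>\<^sub>f: "invariant_via G \<phi> I \<Theta> f \<alpha> \<alpha>\<^sub>f" and \<alpha>\<^sub>g: "invariant_via G \<psi> J \<Theta> g \<alpha> \<alpha>\<^sub>g"
    using f g unfolding G_invariant_def by blast
  note maps = invariant_viaD[OF \<alpha>\<^sub>f] invariant_viaD[OF \<alpha>\<^sub>g]
  \<comment> \<open>The middle parameter enters through \<open>f\<close> if the flag is \<open>0\<close> and through \<open>g\<close> otherwise.\<close>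
  let ?m = "\<lambda>(\<theta>\<^sub>1, \<theta>\<^sub>2, \<theta>\<^sub>3, s::nat). (\<alpha>\<^sub>f \<theta>\<^sub>1, if s = 0 then \<alpha>\<^sub>f \<theta>\<^sub>2 else \<alpha>\<^sub>g \<theta>\<^sub>2, \<alpha>\<^sub>g \<theta>\<^sub>3, s)"
  \<comment> \<open>The flag is preserved, so two arguments with equal images use the same branch in
    the second component, and injectivity of that branch applies.\<close>
  have "inj_on ?m ?\<Theta>'"
    using maps(2,5) by (auto simp: inj_on_def)
  moreover have "?m ` ?\<Theta>' \<subseteq> ?\<Theta>'"
    using maps by auto
  moreover have "\<forall>\<theta>\<in>?\<Theta>'. \<forall>i j. (i, j) \<in> IJ \<longrightarrow>
      ?F \<theta> (\<phi> (inv \<alpha>) i, \<psi> (inv \<alpha>) j) = ?F (?m \<theta>) (i, j)"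
  proof (intro ballI allI impI)
    fix \<theta> i j assume \<theta>: "\<theta> \<in> ?\<Theta>'" and ij: "(i, j) \<in> IJ"
    have [simp]: "i \<in> I" "j \<in> J" using ij by (auto simp: mapping_product_def)
    \<comment> \<open>These identities serve twice: for the two denominators and for the middle
      factor under either flag.\<close>
    have "aggregate p I (f \<theta>') (p (\<phi> (inv \<alpha>) i)) = aggregate p I (f (\<alpha>\<^sub>f \<theta>')) (p i)"
      "aggregate q J (g \<theta>') (q (\<psi> (inv \<alpha>) j)) = aggregate q J (g (\<alpha>\<^sub>g \<theta>')) (q j)"
      if "\<theta>' \<in> \<Theta>" for \<theta>'
      using that \<alpha> maps by (auto intro!: aggregate_p_action aggregate_q_action)
    then show "?F \<theta> (\<phi> (inv \<alpha>) i, \<psi> (inv \<alpha>) j) = ?F (?m \<theta>) (i, j)"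
      using \<theta> maps by (auto simp: super_markov_def)
  qed
  ultimately show "\<exists>\<alpha>'. \<alpha>' ` ?\<Theta>' \<subseteq> ?\<Theta>' \<and> inj_on \<alpha>' ?\<Theta>' \<and> (\<forall>\<theta>\<in>?\<Theta>'. \<forall>i j. (i, j) \<in> IJ \<longrightarrow>
      ?F \<theta> (\<phi> (inv \<alpha>) i, \<psi> (inv \<alpha>) j) = ?F (\<alpha>' \<theta>) (i, j))"
    by blast
qed

lemma structured_super_markov_invariant:
  assumes h: "G_invariant G (base_action p I M \<phi>) M \<Theta> h"
  shows "G_invariant G \<pi> IJ (\<Theta> \<times> \<Theta> \<times> \<Theta>) (structured_super_markov p I q J h f g)"
    (is "G_invariant _ _ _ ?\<Theta>' ?F")
proof (rule G_invariant_prodI)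
  fix \<alpha> assume \<alpha>: "\<alpha> \<in> carrier G"
  then obtain \<alpha>\<^sub>f \<alpha>\<^sub>g
    where \<alpha>\<^sub>f: "invariant_via G \<phi> I \<Theta> f \<alpha> \<alpha>\<^sub>f" and \<alpha>\<^sub>g: "invariant_via G \<psi> J \<Theta> g \<alpha> \<alpha>\<^sub>g"
    using f g unfolding G_invariant_def by blast
  note maps = invariant_viaD[OF \<alpha>\<^sub>f] invariant_viaD[OF \<alpha>\<^sub>g]
  obtain \<alpha>\<^sub>h where \<alpha>\<^sub>h: "invariant_via G (base_action p I M \<phi>) M \<Theta> h \<alpha> \<alpha>\<^sub>h"
    using h \<alpha> by (auto simp: G_invariant_def)
  \<comment> \<open>The middle parameter enters only through \<open>h\<close>, so it moves by the
    map belonging to \<open>h\<close>.\<close>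
  let ?m = "map_prod \<alpha>\<^sub>f (map_prod \<alpha>\<^sub>h \<alpha>\<^sub>g)"
  have "inj_on ?m ?\<Theta>'"
    by (intro map_prod_inj_on maps(2,5) invariant_viaD(2)[OF \<alpha>\<^sub>h])
  moreover have "?m ` ?\<Theta>' \<subseteq> ?\<Theta>'"
    using maps invariant_viaD(1)[OF \<alpha>\<^sub>h] by auto
  moreover have "\<forall>\<theta>\<in>?\<Theta>'. \<forall>i j. (i, j) \<in> IJ \<longrightarrow>
      ?F \<theta> (\<phi> (inv \<alpha>) i, \<psi> (inv \<alpha>) j) = ?F (?m \<theta>) (i, j)"
  proof (intro ballI allI impI)
    fix \<theta> i j assume \<theta>: "\<theta> \<in> ?\<Theta>'" and ij: "(i, j) \<in> IJ"
    have [simp]: "i \<in> I" "j \<in> J" using ij by (auto simp: mapping_product_def)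
    have "p i \<in> M" using p by (auto simp: category_mapping_def)
    \<comment> \<open>Invariance of \<open>h\<close> refers to the induced action on
      \<open>M\<close>; \<open>base_action_eq\<close> identifies the image of \<open>p i\<close>
      under \<open>inv \<alpha>\<close> with \<open>p (\<phi> (inv \<alpha>) i)\<close>.\<close>
    then have "h \<theta>' (p (\<phi> (inv \<alpha>) i)) = h (\<alpha>\<^sub>h \<theta>') (p i)" if "\<theta>' \<in> \<Theta>" for \<theta>'
      using invariant_viaD(3)[OF \<alpha>\<^sub>h that, of "p i"] \<alpha>
      by (simp add: base_action_eq[OF p q compatible])
    moreover have "aggregate p I (f \<theta>') (p (\<phi> (inv \<alpha>) i)) = aggregate p I (f (\<alpha>\<^sub>f \<theta>')) (p i)"
      "aggregate q J (g \<theta>') (q (\<psi> (inv \<alpha>) j)) = aggregate q J (g (\<alpha>\<^sub>g \<theta>')) (q j)"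
      if "\<theta>' \<in> \<Theta>" for \<theta>'
      using that \<alpha> maps by (auto intro!: aggregate_p_action aggregate_q_action)
    ultimately show "?F \<theta> (\<phi> (inv \<alpha>) i, \<psi> (inv \<alpha>) j) = ?F (?m \<theta>) (i, j)"
      using \<theta> maps by (auto simp: structured_super_markov_def)
  qed
  ultimately show "\<exists>\<alpha>'. \<alpha>' ` ?\<Theta>' \<subseteq> ?\<Theta>' \<and> inj_on \<alpha>' ?\<Theta>' \<and> (\<forall>\<theta>\<in>?\<Theta>'. \<forall>i j. (i, j) \<in> IJ \<longrightarrow>
      ?F \<theta> (\<phi> (inv \<alpha>) i, \<psi> (inv \<alpha>) j) = ?F (\<alpha>' \<theta>) (i, j))"
    by blast
qed

end

end

theorem theorem34:
  fixes G :: "('g, 'b) monoid_scheme"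
    and I :: "'i set" and J :: "'j set" and M :: "'m set"
    and p :: "'i \<Rightarrow> 'm" and q :: "'j \<Rightarrow> 'm"
    and \<phi> :: "'g \<Rightarrow> 'i \<Rightarrow> 'i" and \<psi> :: "'g \<Rightarrow> 'j \<Rightarrow> 'j"
    and \<Theta> :: "'t set"
    and f :: "'t \<Rightarrow> 'i \<Rightarrow> real" and g :: "'t \<Rightarrow> 'j \<Rightarrow> real"
  assumes "category_mapping I M p" and "category_mapping J M q"
    and "group_action G I \<phi>" and "group_action G J \<psi>"
    and "compatible_action G \<phi> I \<psi> J p q"
    and "stat_model \<Theta> I f" and "G_invariant G \<phi> I \<Theta> f"
    and "stat_model \<Theta> J g" and "G_invariant G \<psi> J \<Theta> g"
  shows "group_action G (mapping_product p I q J) (prod_action p I q J \<phi> \<psi>) \<and>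
    (jointly_G_invariant G \<phi> I \<psi> J \<Theta> f g \<and> meta_consistent p I q J M \<Theta> f g \<longrightarrow>
      G_invariant G (prod_action p I q J \<phi> \<psi>) (mapping_product p I q J)
        \<Theta> (meta_markov p I f g)) \<and>
    G_invariant G (prod_action p I q J \<phi> \<psi>) (mapping_product p I q J)
        (lower_params p I q J M \<Theta> f g) (lower_markov p I f g) \<and>
    G_invariant G (prod_action p I q J \<phi> \<psi>) (mapping_product p I q J)
        (\<Theta> \<times> \<Theta> \<times> {0, 1}) (upper_markov p I q J f g) \<and>
    G_invariant G (prod_action p I q J \<phi> \<psi>) (mapping_product p I q J)
        (\<Theta> \<times> \<Theta> \<times> \<Theta> \<times> {0, 1}) (super_markov p I q J f g) \<and>
    (\<forall>h. stat_model \<Theta> M h \<and> G_invariant G (base_action p I M \<phi>) M \<Theta> h \<longrightarrow>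
      G_invariant G (prod_action p I q J \<phi> \<psi>) (mapping_product p I q J)
        (\<Theta> \<times> \<Theta> \<times> \<Theta>) (structured_super_markov p I q J h f g))"
proof -
  interpret compatible_group_actions G I J M p q \<phi> \<psi>
    using assms(1-5) by (rule compatible_group_actions.intro)
  show ?thesis
    using prod_group_action meta_markov_invariant lower_markov_invariant[OF assms(7,9)]
      upper_markov_invariant[OF assms(7,9)] super_markov_invariant[OF assms(7,9)]
      structured_super_markov_invariant[OF assms(7,9)]
    by blast
qed

end
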